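(* Let $N\ge 1$ be an integer, and let $\psi:\mathbb{Q}[x_0,\ldots,x_N]\to\mathbb{Q}[x_0,\ldots,x_N]$ be a $(\mathcal{D},\mathcal{D}_{\mathcal{K}_2})$-intertwining map, and suppose that it has the form $$\psi(x_0)=x_0,\qquad \psi(x_n)=\sum_{i=1}^n B(n,i)\,x_i\quad(1\le n\le N).$$ Then $$B(n,k)=k!\,S(n,k),$$ where $S(n,k)$ are the Stirling numbers of the second kind.
   Context: A derivation of $\mathbb{Q}[x_0,\ldots,x_N]$ is a $\mathbb{Q}$-linear map satisfying the Leibniz rule; it is determined by its values on the variables. The basic Weitzenböck derivation is $\mathcal{D}=x_0\frac{\partial}{\partial x_1}+2x_1\frac{\partial}{\partial x_2}+\cdots+N x_{N-1}\frac{\partial}{\partial x_N}$, i.e. $\mathcal{D}(x_0)=0$ and $\mathcal{D}(x_n)=n\,x_{n-1}$ for $1\le n\le N$. The second Kravchuk derivation $\mathcal{D}_{\mathcal{K}_2}$ is the derivation with $$\mathcal{D}_{\mathcal{K}_2}(x_0)=0,\qquad \mathcal{D}_{\mathcal{K}_2}(x_n)=\sum_{i=0}^{n-1}\frac{(-1)^{n+1+i}}{n-i}\,x_i\quad(1\le n\le N).$$ A $(\mathcal{D},\mathcal{D}_{\mathcal{K}_2})$-intertwining map is a multiplicative linear map $\psi$ with $\psi\,\mathcal{D}=\mathcal{D}_{\mathcal{K}_2}\psi$. The coefficients $B(n,k)$ are those with $1\le k\le n\le N$. *)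

theory Defs
  imports Complex_Main "HOL-Library.Poly_Mapping" "HOL-Library.FuncSet" "HOL-Combinatorics.Stirling"
begin

section \<open>The polynomial ring in $x_0, \dots, x_N$ over the rationals\<close>

text \<open>
  Polynomials over the rationals in the countably many variables $x_0, x_1, \dots$ are finitely
  supported maps from exponent vectors to coefficients, with the convolution product of
  \<^theory>\<open>HOL-Library.Poly_Mapping\<close>.  The ring in $x_0, \dots, x_N$ is the carrier set
  \<open>poly_ring N\<close>, and maps on it are total functions of which only the values on the carrier matter.
\<close>

type_synonym qpoly = "(nat \<Rightarrow>\<^sub>0 nat) \<Rightarrow>\<^sub>0 rat"

definition C :: "rat \<Rightarrow> qpoly"
  where "C c = Poly_Mapping.single 0 c"

definition X :: "nat \<Rightarrow> qpoly"
  where "X i = Poly_Mapping.single (Poly_Mapping.single i 1) 1"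

definition poly_ring :: "nat \<Rightarrow> qpoly set"
  where "poly_ring N = {f. \<forall>m \<in> Poly_Mapping.keys f. Poly_Mapping.keys m \<subseteq> {..N}}"

definition q_linear :: "nat \<Rightarrow> (qpoly \<Rightarrow> qpoly) \<Rightarrow> bool"
  where "q_linear N \<phi> \<longleftrightarrow>
    \<phi> \<in> poly_ring N \<rightarrow> poly_ring N \<and>
    (\<forall>f \<in> poly_ring N. \<forall>g \<in> poly_ring N. \<phi> (f + g) = \<phi> f + \<phi> g) \<and>
    (\<forall>c. \<forall>f \<in> poly_ring N. \<phi> (C c * f) = C c * \<phi> f)"

definition multiplicative :: "nat \<Rightarrow> (qpoly \<Rightarrow> qpoly) \<Rightarrow> bool"
  where "multiplicative N \<phi> \<longleftrightarrow>
    (\<forall>f \<in> poly_ring N. \<forall>g \<in> poly_ring N. \<phi> (f * g) = \<phi> f * \<phi> g)"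

definition derivation :: "nat \<Rightarrow> (qpoly \<Rightarrow> qpoly) \<Rightarrow> bool"
  where "derivation N d \<longleftrightarrow>
    q_linear N d \<and>
    (\<forall>f \<in> poly_ring N. \<forall>g \<in> poly_ring N. d (f * g) = d f * g + f * d g)"

section \<open>The two derivations\<close>

text \<open>
  The partial derivative with respect to $x_i$, monomial by monomial.  The truncated subtraction
  of exponents is harmless: if $x_i$ does not occur in \<open>m\<close>, the coefficient is \<open>0\<close>.
\<close>

definition partial :: "nat \<Rightarrow> qpoly \<Rightarrow> qpoly"
  where "partial i f = (\<Sum>m \<in> Poly_Mapping.keys f.
    Poly_Mapping.single (m - Poly_Mapping.single i 1)
      (Poly_Mapping.lookup f m * of_nat (Poly_Mapping.lookup m i)))"

definition weitzenboeck :: "nat \<Rightarrow> qpoly \<Rightarrow> qpoly"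
  where "weitzenboeck N f = (\<Sum>n = 1..N. C (of_nat n) * X (n - 1) * partial n f)"

definition kravchuk2_value :: "nat \<Rightarrow> qpoly"
  where "kravchuk2_value n = (\<Sum>i<n. C ((-1) ^ (n + 1 + i) / of_nat (n - i)) * X i)"

text \<open>
  A derivation is determined by its values on the variables (\<open>derivation_unique\<close> below), and the
  one with values $v_n$ at $x_n$ is $\sum_n v_n \partial/\partial x_n$.
\<close>

definition kravchuk2 :: "nat \<Rightarrow> qpoly \<Rightarrow> qpoly"
  where "kravchuk2 N f = (\<Sum>n = 1..N. kravchuk2_value n * partial n f)"

definition intertwining ::
    "nat \<Rightarrow> (qpoly \<Rightarrow> qpoly) \<Rightarrow> (qpoly \<Rightarrow> qpoly) \<Rightarrow> (qpoly \<Rightarrow> qpoly) \<Rightarrow> bool"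
  where "intertwining N d\<^sub>1 d\<^sub>2 \<psi> \<longleftrightarrow>
    q_linear N \<psi> \<and> multiplicative N \<psi> \<and> (\<forall>f \<in> poly_ring N. \<psi> (d\<^sub>1 f) = d\<^sub>2 (\<psi> f))"

section \<open>The derivations have the prescribed values, and these determine them\<close>

lemma keys_plus_nat:
  fixes a b :: "nat \<Rightarrow>\<^sub>0 nat"
  shows "Poly_Mapping.keys (a + b) = Poly_Mapping.keys a \<union> Poly_Mapping.keys b"
  by (auto simp: in_keys_iff lookup_add)

lemma poly_ring_0: "0 \<in> poly_ring N"
  by (simp add: poly_ring_def)

lemma poly_ring_add: "f \<in> poly_ring N \<Longrightarrow> g \<in> poly_ring N \<Longrightarrow> f + g \<in> poly_ring N"
  using Poly_Mapping.keys_add[of f g] by (auto simp: poly_ring_def subset_iff)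

lemma poly_ring_sum: "(\<And>i. i \<in> I \<Longrightarrow> f i \<in> poly_ring N) \<Longrightarrow> sum f I \<in> poly_ring N"
  by (induction I rule: infinite_finite_induct) (auto intro: poly_ring_0 poly_ring_add)

lemma poly_ring_mult:
  assumes "f \<in> poly_ring N" "g \<in> poly_ring N" shows "f * g \<in> poly_ring N"
  unfolding poly_ring_def
proof safe
  fix m i assume "m \<in> Poly_Mapping.keys (f * g)" and i: "i \<in> Poly_Mapping.keys m"
  then obtain a b where "m = a + b" "a \<in> Poly_Mapping.keys f" "b \<in> Poly_Mapping.keys g"
    using Poly_Mapping.keys_mult[of f g] by auto
  with i assms show "i \<le> N"
    by (auto simp: poly_ring_def keys_plus_nat)
qed

lemma poly_ring_single: "Poly_Mapping.keys m \<subseteq> {..N} \<Longrightarrow> Poly_Mapping.single m c \<in> poly_ring N"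
  by (auto simp: poly_ring_def split: if_splits)

lemma poly_ring_C: "C c \<in> poly_ring N"
  by (simp add: C_def poly_ring_single)

lemma poly_ring_X: "X i \<in> poly_ring N \<longleftrightarrow> i \<le> N"
  by (auto simp: X_def poly_ring_def)

lemma poly_ring_partial:
  assumes "f \<in> poly_ring N" shows "partial i f \<in> poly_ring N"
  unfolding partial_def
proof (intro poly_ring_sum poly_ring_single)
  fix m assume "m \<in> Poly_Mapping.keys f"
  with assms have "Poly_Mapping.keys m \<subseteq> {..N}"
    by (simp add: poly_ring_def)
  moreover have "Poly_Mapping.keys (m - Poly_Mapping.single i 1) \<subseteq> Poly_Mapping.keys m"
    by (auto simp: in_keys_iff lookup_minus)
  ultimately show "Poly_Mapping.keys (m - Poly_Mapping.single i 1) \<subseteq> {..N}"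
    by (rule order_trans[rotated])
qed

lemma lookup_partial:
  "Poly_Mapping.lookup (partial i f) m =
    Poly_Mapping.lookup f (m + Poly_Mapping.single i 1) * of_nat (Poly_Mapping.lookup m i + 1)"
proof -
  let ?m = "m + Poly_Mapping.single i 1"
  have eq: "k = ?m" if "k - Poly_Mapping.single i 1 = m" "Poly_Mapping.lookup k i \<noteq> 0" for k
  proof (rule poly_mapping_eqI)
    fix j
    show "Poly_Mapping.lookup k j = Poly_Mapping.lookup ?m j"
      using that by (cases "i = j") (auto simp: lookup_add lookup_minus lookup_single)
  qed
  have eq': "?m - Poly_Mapping.single i 1 = m"
    by simp
  have "Poly_Mapping.lookup (partial i f) m = (\<Sum>k \<in> Poly_Mapping.keys f.
      if k = ?m then Poly_Mapping.lookup f k * of_nat (Poly_Mapping.lookup k i) else 0)"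
    unfolding partial_def lookup_sum
    by (intro sum.cong refl) (use eq eq' in \<open>auto simp: lookup_single when_def\<close>)
  also have "\<dots> = Poly_Mapping.lookup f ?m * of_nat (Poly_Mapping.lookup ?m i)"
    by (simp add: sum.delta' sum.delta in_keys_iff)
  finally show ?thesis by (simp add: lookup_add)
qed

lemma partial_add: "partial i (f + g) = partial i f + partial i g"
  by (rule poly_mapping_eqI) (simp add: lookup_partial lookup_add algebra_simps)

lemma partial_zero: "partial i 0 = 0"
  by (simp add: partial_def)

lemma partial_single:
  "partial i (Poly_Mapping.single a c) =
    Poly_Mapping.single (a - Poly_Mapping.single i 1) (c * of_nat (Poly_Mapping.lookup a i))"
  by (cases "c = 0") (auto simp: partial_def)

lemma poly_mapping_single_induct [case_names zero add]:
  fixes f :: "'a \<Rightarrow>\<^sub>0 'b::comm_monoid_add"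
  assumes "P 0"
    and "\<And>f a b. a \<notin> Poly_Mapping.keys f \<Longrightarrow> b \<noteq> 0 \<Longrightarrow> P f \<Longrightarrow> P (Poly_Mapping.single a b + f)"
  shows "P f"
proof (induction f rule: update_induct)
  case (update f a b)
  have "Poly_Mapping.update a b f = Poly_Mapping.single a b + f"
    using update(1) by (intro poly_mapping_eqI)
      (auto simp: lookup_update lookup_add lookup_single in_keys_iff when_def)
  with assms(2)[OF update] show ?case by simp
qed (rule assms)

lemma partial_mult_single:
  "partial i (Poly_Mapping.single a c * Poly_Mapping.single b d) =
    partial i (Poly_Mapping.single a c) * Poly_Mapping.single b d +
    Poly_Mapping.single a c * partial i (Poly_Mapping.single b d)"
proof -
  let ?e = "Poly_Mapping.single i (1::nat)"
  have 1: "Poly_Mapping.single (a + b - ?e) (c * d * of_nat (Poly_Mapping.lookup a i)) =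
     Poly_Mapping.single (a - ?e + b) (c * d * of_nat (Poly_Mapping.lookup a i))"
  proof (cases "Poly_Mapping.lookup a i = 0")
    case False
    then have "a + b - ?e = a - ?e + b"
      by (intro poly_mapping_eqI) (auto simp: lookup_add lookup_minus lookup_single when_def)
    then show ?thesis by simp
  qed simp
  have 2: "Poly_Mapping.single (a + b - ?e) (c * d * of_nat (Poly_Mapping.lookup b i)) =
     Poly_Mapping.single (a + (b - ?e)) (c * d * of_nat (Poly_Mapping.lookup b i))"
  proof (cases "Poly_Mapping.lookup b i = 0")
    case False
    then have "a + b - ?e = a + (b - ?e)"
      by (intro poly_mapping_eqI) (auto simp: lookup_add lookup_minus lookup_single when_def)
    then show ?thesis by simp
  qed simp
  show ?thesis
    using 1 2 by (simp add: mult_single partial_single lookup_add distrib_left single_add mult_ac add_ac)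
qed

lemma partial_mult: "partial i (f * g) = partial i f * g + f * partial i g"
proof (induction f rule: poly_mapping_single_induct)
  case (add f a b)
  have "partial i (Poly_Mapping.single a b * g) =
      partial i (Poly_Mapping.single a b) * g + Poly_Mapping.single a b * partial i g"
    by (induction g rule: poly_mapping_single_induct)
       (simp_all add: partial_zero partial_add partial_mult_single distrib_left add_ac)
  with add show ?case
    by (simp add: partial_add distrib_right add_ac)
qed (simp add: partial_zero)

lemma partial_C: "partial i (C c) = 0"
  by (simp add: C_def partial_single)

lemma partial_X: "partial i (X j) = (if i = j then 1 else 0)"
  by (simp add: X_def partial_single lookup_single when_def)

lemma mult_partial_X: "f * partial i (X j) = (if i = j then f else 0)"
  by (simp add: partial_X)

lemma derivation_sum_partial:
  assumes "\<And>n. n \<in> I \<Longrightarrow> v n \<in> poly_ring N"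
  shows "derivation N (\<lambda>f. \<Sum>n\<in>I. v n * partial n f)"
proof -
  let ?d = "\<lambda>f. \<Sum>n\<in>I. v n * partial n f"
  have "?d f \<in> poly_ring N" if "f \<in> poly_ring N" for f
    by (intro poly_ring_sum poly_ring_mult poly_ring_partial assms that)
  moreover have "?d (f + g) = ?d f + ?d g" for f g
    by (simp add: partial_add distrib_left sum.distrib)
  moreover have "?d (C c * f) = C c * ?d f" for c f
    by (simp add: partial_mult partial_C sum_distrib_left mult.left_commute)
  moreover have "?d (f * g) = ?d f * g + f * ?d g" for f g
  proof -
    have "v n * partial n (f * g) = v n * partial n f * g + f * (v n * partial n g)" for n
      by (simp add: partial_mult distrib_left mult.assoc mult.left_commute)
    then show ?thesis
      by (simp add: sum.distrib sum_distrib_left sum_distrib_right)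
  qed
  ultimately show ?thesis
    unfolding derivation_def q_linear_def by blast
qed

lemma kravchuk2_value_in_poly_ring: "n \<le> N \<Longrightarrow> kravchuk2_value n \<in> poly_ring N"
  unfolding kravchuk2_value_def
  by (intro poly_ring_sum poly_ring_mult poly_ring_C) (simp add: poly_ring_X)

lemma derivation_weitzenboeck: "derivation N (weitzenboeck N)"
proof -
  have "weitzenboeck N = (\<lambda>f. \<Sum>n = 1..N. (C (of_nat n) * X (n - 1)) * partial n f)"
    by (simp add: weitzenboeck_def fun_eq_iff)
  moreover have "derivation N \<dots>"
    by (intro derivation_sum_partial poly_ring_mult poly_ring_C) (auto simp: poly_ring_X)
  ultimately show ?thesis by simp
qed

lemma weitzenboeck_X:
  "weitzenboeck N (X 0) = 0"
  "1 \<le> n \<Longrightarrow> n \<le> N \<Longrightarrow> weitzenboeck N (X n) = C (of_nat n) * X (n - 1)"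
  by (simp_all add: weitzenboeck_def mult_partial_X)

lemma derivation_kravchuk2: "derivation N (kravchuk2 N)"
proof -
  have "kravchuk2 N = (\<lambda>f. \<Sum>n = 1..N. kravchuk2_value n * partial n f)"
    by (simp add: kravchuk2_def fun_eq_iff)
  moreover have "derivation N \<dots>"
    by (intro derivation_sum_partial kravchuk2_value_in_poly_ring) simp
  ultimately show ?thesis by simp
qed

lemma kravchuk2_X:
  "kravchuk2 N (X 0) = 0"
  "1 \<le> n \<Longrightarrow> n \<le> N \<Longrightarrow>
    kravchuk2 N (X n) = (\<Sum>i<n. C ((-1) ^ (n + 1 + i) / of_nat (n - i)) * X i)"
  unfolding kravchuk2_value_def[symmetric] by (simp_all add: kravchuk2_def mult_partial_X)

lemma derivation_one:
  assumes "derivation N d" shows "d 1 = 0"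
proof -
  have "(1::qpoly) \<in> poly_ring N"
    using poly_ring_C[of 1 N] by (simp add: C_def)
  then have "d (1 * 1) = d 1 * 1 + 1 * d 1"
    using assms unfolding derivation_def by blast
  then show ?thesis by simp
qed

lemma derivation_unique_power:
  assumes "derivation N d" "derivation N e" "d (X i) = e (X i)" "i \<le> N"
  shows "X i ^ k \<in> poly_ring N \<and> d (X i ^ k) = e (X i ^ k)"
proof (induction k)
  case 0
  show ?case
    using poly_ring_C[of 1 N] derivation_one[OF assms(1)] derivation_one[OF assms(2)]
    by (simp add: C_def)
next
  case (Suc k)
  have "X i \<in> poly_ring N" using assms(4) by (simp add: poly_ring_X)
  with Suc assms show ?case
    unfolding derivation_def by (simp add: poly_ring_mult)
qed

lemma X_power: "X i ^ k = Poly_Mapping.single (Poly_Mapping.single i k) 1"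
  by (induction k) (simp_all add: X_def mult_single flip: single_add)

lemma derivation_unique:
  assumes d: "derivation N d" and e: "derivation N e"
    and X: "\<And>n. n \<le> N \<Longrightarrow> d (X n) = e (X n)"
    and f: "f \<in> poly_ring N"
  shows "d f = e f"
proof -
  have mono: "d (Poly_Mapping.single m 1) = e (Poly_Mapping.single m 1)"
    if "Poly_Mapping.keys m \<subseteq> {..N}" for m
    using that
  proof (induction m rule: poly_mapping_single_induct)
    case zero
    then show ?case using derivation_one[OF d] derivation_one[OF e] by simp
  next
    case (add m i k)
    have i: "i \<le> N" and m: "Poly_Mapping.keys m \<subseteq> {..N}"
      using add.prems add.hyps by (auto simp: keys_plus_nat)
    have "Poly_Mapping.single (Poly_Mapping.single i k + m) (1::rat) =
        X i ^ k * Poly_Mapping.single m 1"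
      by (simp add: X_power mult_single)
    then show ?case
      using derivation_unique_power[OF d e X[OF i] i, of k] add.IH[OF m] d e
        poly_ring_single[OF m, of 1]
      unfolding derivation_def by simp
  qed
  have scaled: "d (Poly_Mapping.single m c) = e (Poly_Mapping.single m c)"
    if m: "Poly_Mapping.keys m \<subseteq> {..N}" for m c
  proof -
    have "Poly_Mapping.single m c = C c * Poly_Mapping.single m 1"
      by (simp add: C_def mult_single)
    then show ?thesis
      using mono[OF m] d e poly_ring_single[OF m, of 1]
      unfolding derivation_def q_linear_def by simp
  qed
  have zero: "d 0 = e 0"
    using scaled[of 0 0] by simp
  show ?thesis
    using f
  proof (induction f rule: poly_mapping_single_induct)
    case (add f m c)
    have keys: "Poly_Mapping.keys (Poly_Mapping.single m c + f) = insert m (Poly_Mapping.keys f)"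
      using add.hyps by (auto simp: in_keys_iff lookup_add lookup_single when_def split: if_splits)
    have m: "Poly_Mapping.keys m \<subseteq> {..N}" and f: "f \<in> poly_ring N"
      using add.prems by (simp_all add: poly_ring_def keys)
    show ?case
      using add.IH[OF f] scaled[OF m, of c] d e f poly_ring_single[OF m, of c]
      unfolding derivation_def q_linear_def by simp
  qed (rule zero)
qed

end

theory Submission
  imports Defs
begin

text \<open>
  Comparing the coefficients of the variables in the intertwining identity at \<open>X (Suc n)\<close> gives, for
  each \<open>n\<close>, a triangular linear system expressing row \<open>Suc n\<close> of \<open>B\<close> through row \<open>n\<close>, with
  nonzero diagonal; so the rows are unique.  The numbers $k!\,S(n,k)$ solve these systems: under
  $x_k \mapsto \binom{t}{k}$ the second Kravchuk derivation becomes $\frac{d}{dt} = \log(1+\Delta)$,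
  and $t^n = \sum_k k!\,S(n,k) \binom{t}{k}$ has derivative $n t^{n-1}$.
\<close>

text \<open>The coefficient of binom(t,k) in t^n; equivalently, the number of surjections from an
  n-set onto a k-set.\<close>

definition surj_count :: "nat \<Rightarrow> nat \<Rightarrow> rat"
  where "surj_count n k = fact k * of_nat (Stirling n k)"

lemma surj_count_0_left: "surj_count 0 k = (if k = 0 then 1 else 0)"
  by (cases k) (simp_all add: surj_count_def)

lemma surj_count_Suc_0: "surj_count (Suc n) 0 = 0"
  by (simp add: surj_count_def)

text \<open>Multiplication by t in the binomial basis: t binom(t,k) = k binom(t,k) + (k+1)
  binom(t,k+1).\<close>

lemma surj_count_Suc_Suc:
  "surj_count (Suc n) (Suc k) = of_nat (Suc k) * (surj_count n (Suc k) + surj_count n k)"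
  by (simp add: surj_count_def algebra_simps)

lemma surj_count_eq_0: "n < k \<Longrightarrow> surj_count n k = 0"
  by (simp add: surj_count_def)

lemma alternating_telescope:
  fixes f :: "nat \<Rightarrow> 'a::comm_ring_1"
  shows "(\<Sum>m<M. (-1) ^ m * (f (Suc m) + f m)) = f 0 - (-1) ^ M * f M"
  by (induction M) (simp_all add: algebra_simps)

text \<open>Coefficient of binom(t,j) in log(1+Delta) t^n = n t^(n-1), because Delta^(m+1) moves the
  coefficient at j+m+1 down to j. The bound on \<open>M\<close> ensures that the truncated series
  loses only zero terms. The induction mirrors the product rule for t * t^n.\<close>

lemma log_diff_surj_count:
  assumes "n \<le> j + M"
  shows "(\<Sum>m<M. (-1) ^ m / of_nat (Suc m) * surj_count n (j + Suc m))
    = of_nat n * surj_count (n - 1) j"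
  using assms
proof (induction n arbitrary: j)
  case 0
  then show ?case by (simp add: surj_count_eq_0)
next
  case (Suc n)
  define L where "L i = (\<Sum>m<M. (-1) ^ m / of_nat (Suc m) * surj_count n (i + Suc m))" for i
  define L' where "L' = (\<Sum>m<M. (-1) ^ m / of_nat (Suc m) * surj_count n (j + m))"
  \<comment> \<open>The recurrence contributes the factor j + (m+1). Its part j leads to the
    induction hypothesis at j and j-1; its part m+1 cancels the denominator and leaves a telescoping
    sum.\<close>
  have summand: "(-1) ^ m / of_nat (Suc m) * surj_count (Suc n) (j + Suc m) =
      of_nat j * ((-1) ^ m / of_nat (Suc m) * surj_count n (j + Suc m)
        + (-1) ^ m / of_nat (Suc m) * surj_count n (j + m))
      + (-1) ^ m * (surj_count n (j + Suc m) + surj_count n (j + m))" for m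
  proof -
    have split: "of_nat (Suc (j + m)) = (of_nat j + of_nat (Suc m) :: rat)"
      by simp
    have "of_nat (Suc m) \<noteq> (0 :: rat)"
      by (rule of_nat_neq_0)
    then show ?thesis
      unfolding add_Suc_right surj_count_Suc_Suc split
      by (simp add: field_simps del: of_nat_Suc)
  qed
  have "(\<Sum>m<M. (-1) ^ m / of_nat (Suc m) * surj_count (Suc n) (j + Suc m)) =
      of_nat j * (L j + L')
      + (\<Sum>m<M. (-1) ^ m * (surj_count n (j + Suc m) + surj_count n (j + m)))"
    unfolding summand L_def L'_def by (simp only: sum.distrib sum_distrib_left distrib_left)
  \<comment> \<open>The far end of the telescope is zero, since \<open>Suc n \<le> j + M\<close>
    puts \<open>j + M\<close> beyond row \<open>n\<close>.\<close>
  also have "(\<Sum>m<M. (-1) ^ m * (surj_count n (j + Suc m) + surj_count n (j + m)))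
      = surj_count n j"
    using alternating_telescope[of "\<lambda>m. surj_count n (j + m)" M] Suc.prems
    by (simp add: surj_count_eq_0)
  also have "of_nat j * (L j + L') = of_nat n * surj_count n j"
  \<comment> \<open>\<open>L'\<close> is \<open>L\<close> at j-1, which exists only for positive j;
    at j = 0 both sides vanish.\<close>
  proof (cases j)
    case 0
    then show ?thesis by (cases n) (simp_all add: surj_count_Suc_0)
  next
    case (Suc i)
    then have "L' = L i"
      by (simp add: L_def L'_def)
    moreover have "L j = of_nat n * surj_count (n - 1) j" "L i = of_nat n * surj_count (n - 1) i"
      using Suc.IH[of j] Suc.IH[of i] Suc.prems \<open>j = Suc i\<close> unfolding L_def by simp_all
    ultimately show ?thesis
      using Suc by (cases n) (simp_all add: surj_count_Suc_Suc algebra_simps)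
  qed
  finally show ?case by (simp add: algebra_simps)
qed

text \<open>The coefficient of x_j in the second Kravchuk derivative of x_k. The zeros for
  \<open>j \<ge> k\<close> make the matrix strictly triangular, so sums may run over all k.\<close>

definition log_coeff :: "nat \<Rightarrow> nat \<Rightarrow> rat"
  where "log_coeff k j = (if j < k then (-1) ^ (k + 1 + j) / of_nat (k - j) else 0)"

text \<open>Substituting k = j+m+1 turns the sign exponent into 2j+m+2, which has the parity of
  m.\<close>

lemma sum_log_coeff:
  assumes "j \<le> n"
  shows "(\<Sum>k=1..n. f k * log_coeff k j)
    = (\<Sum>m<n - j. (-1) ^ m / of_nat (Suc m) * f (j + Suc m))"
proof -
  have "(\<Sum>k=1..n. f k * log_coeff k j) = (\<Sum>k\<in>{Suc j..<Suc n}. f k * log_coeff k j)"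
    by (rule sum.mono_neutral_right) (auto simp: log_coeff_def)
  also have "\<dots> = (\<Sum>m<n - j. f (j + Suc m) * log_coeff (j + Suc m) j)"
    using assms by (simp add: sum.atLeastLessThan_shift_0 atLeast0LessThan add.commute)
  also have "\<dots> = (\<Sum>m<n - j. (-1) ^ m / of_nat (Suc m) * f (j + Suc m))"
  proof (rule sum.cong)
    fix m
    have "(-1 :: rat) ^ (j + Suc m + 1 + j) = (-1) ^ m * ((-1) ^ j * (-1) ^ j)"
      by (simp add: power_add)
    then show "f (j + Suc m) * log_coeff (j + Suc m) j = (-1) ^ m / of_nat (Suc m) * f (j + Suc m)"
      by (simp add: log_coeff_def flip: power_mult_distrib)
  qed simp
  finally show ?thesis .
qed

lemma surj_count_recurrence:
  assumes "j \<le> n"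
  shows "(\<Sum>k=1..Suc n. surj_count (Suc n) k * log_coeff k j)
    = of_nat (Suc n) * surj_count n j"
  using assms sum_log_coeff[of j "Suc n" "surj_count (Suc n)"]
    log_diff_surj_count[of "Suc n" j "Suc n - j"]
  by (simp del: of_nat_Suc)

text \<open>Back substitution from k = n downwards: equation j = k-1 involves only the unknowns k,
  ..., n, and the coefficient of the k-th is 1.\<close>

lemma log_system_unique:
  assumes eq: "\<And>j. j < n \<Longrightarrow>
      (\<Sum>k=1..n. f k * log_coeff k j) = (\<Sum>k=1..n. g k * log_coeff k j)"
    and k: "1 \<le> k" "k \<le> n"
  shows "f k = g k"
  using k
proof (induction "n - k" arbitrary: k rule: less_induct)
  case less
  have "f i * log_coeff i (k - 1) = g i * log_coeff i (k - 1)" if "i \<in> {1..n} - {k}" for i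
  proof (cases "k < i")
    case True
    then have "f i = g i"
      using less that by simp
    then show ?thesis by simp
  next
    case False
    then show ?thesis using that less.prems by (simp add: log_coeff_def)
  qed
  then have "(\<Sum>i\<in>{1..n} - {k}. f i * log_coeff i (k - 1)) =
      (\<Sum>i\<in>{1..n} - {k}. g i * log_coeff i (k - 1))"
    by (rule sum.cong[OF refl])
  moreover have "(\<Sum>i=1..n. h i * log_coeff i (k - 1)) =
      h k * log_coeff k (k - 1) + (\<Sum>i\<in>{1..n} - {k}. h i * log_coeff i (k - 1))" for h
    using less.prems by (subst sum.remove[of _ k]) simp_all
  moreover have "(\<Sum>i=1..n. f i * log_coeff i (k - 1)) = (\<Sum>i=1..n. g i * log_coeff i (k - 1))"
    using less.prems by (intro eq) simp
  ultimately have "f k * log_coeff k (k - 1) = g k * log_coeff k (k - 1)"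
    by simp
  moreover have "log_coeff k (k - 1) \<noteq> 0"
    using less.prems by (simp add: log_coeff_def)
  ultimately show ?case by simp
qed

abbreviation var_coeff :: "qpoly \<Rightarrow> nat \<Rightarrow> rat"
  where "var_coeff f j \<equiv> Poly_Mapping.lookup f (Poly_Mapping.single j (Suc 0))"

lemma lookup_C_mult: "Poly_Mapping.lookup (C c * f) m = c * Poly_Mapping.lookup f m"
proof (induction f rule: poly_mapping_single_induct)
  case (add f a b)
  then show ?case
    by (simp add: distrib_left lookup_add) (simp add: C_def mult_single lookup_single when_def)
qed simp

lemma var_coeff_X: "var_coeff (X i) j = (if i = j then 1 else 0)"
proof -
  have "Poly_Mapping.single i (Suc 0) = Poly_Mapping.single j (Suc 0) \<longleftrightarrow> i = j"
    by (metis lookup_single_eq lookup_single_not_eq nat.distinct(1))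
  then show ?thesis by (simp add: X_def lookup_single when_def)
qed

lemma var_coeff_C_mult_X: "var_coeff (C c * X i) j = (if i = j then c else 0)"
  by (simp add: lookup_C_mult var_coeff_X)

lemma var_coeff_kravchuk2_value: "var_coeff (kravchuk2_value k) j = log_coeff k j"
  by (simp add: kravchuk2_value_def log_coeff_def lookup_sum var_coeff_C_mult_X)

lemma q_linear_sum:
  assumes lin: "q_linear N \<phi>" and f: "\<And>i. i \<in> I \<Longrightarrow> f i \<in> poly_ring N"
  shows "\<phi> (\<Sum>i\<in>I. f i) = (\<Sum>i\<in>I. \<phi> (f i))"
proof -
  have "\<phi> (0 + 0) = \<phi> 0 + \<phi> 0"
    using lin poly_ring_0 unfolding q_linear_def by blast
  \<comment> \<open>Settles the empty index set and the infinite one, where the sum is 0 by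
    convention.\<close>
  then have zero: "\<phi> 0 = 0" by simp
  show ?thesis
    using f
  proof (induction I rule: infinite_finite_induct)
    case (insert i I)
    have "\<phi> (f i + sum f I) = \<phi> (f i) + \<phi> (sum f I)"
      using lin insert.prems poly_ring_sum[of I f N] unfolding q_linear_def by simp
    with insert show ?case by simp
  qed (simp_all add: zero)
qed

theorem lemma3p2:
  fixes N :: nat and \<psi> :: "qpoly \<Rightarrow> qpoly" and B :: "nat \<Rightarrow> nat \<Rightarrow> rat"
  assumes "N \<ge> 1"
    and "intertwining N (weitzenboeck N) (kravchuk2 N) \<psi>"
    and "\<psi> (X 0) = X 0"
    and "\<And>n. 1 \<le> n \<Longrightarrow> n \<le> N \<Longrightarrow> \<psi> (X n) = (\<Sum>i = 1..n. C (B n i) * X i)"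
  shows "\<forall>n k. 1 \<le> k \<and> k \<le> n \<and> n \<le> N \<longrightarrow> B n k = fact k * of_nat (Stirling n k)"
proof -
  have lin: "q_linear N \<psi>"
    and comm: "\<And>f. f \<in> poly_ring N \<Longrightarrow> \<psi> (weitzenboeck N f) = kravchuk2 N (\<psi> f)"
    using assms(2) by (auto simp: intertwining_def)
  have klin: "q_linear N (kravchuk2 N)"
    using derivation_kravchuk2 by (simp add: derivation_def)
  have coeff: "var_coeff (\<psi> (X n)) k = (if 1 \<le> k \<and> k \<le> n then B n k else 0)"
    if "1 \<le> n" "n \<le> N" for n k
    using assms(4)[OF that]
    by (auto simp: lookup_sum var_coeff_C_mult_X)
  \<comment> \<open>Compare the coefficients of x_j on both sides of the intertwining identity at
    \<open>X (Suc n)\<close>. Coefficients of \<psi>(x_n) replace \<open>B n j\<close> so that row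
    0, given by \<psi>(x_0) = x_0, is covered.\<close>
  have recurrence: "(\<Sum>k=1..Suc n. var_coeff (\<psi> (X (Suc n))) k * log_coeff k j)
      = of_nat (Suc n) * var_coeff (\<psi> (X n)) j" if n: "Suc n \<le> N" for n j
  proof -
    have "C (of_nat (Suc n)) * \<psi> (X n) = \<psi> (weitzenboeck N (X (Suc n)))"
      using lin n by (simp add: weitzenboeck_X q_linear_def poly_ring_X)
    also have "\<dots> = kravchuk2 N (\<Sum>i=1..Suc n. C (B (Suc n) i) * X i)"
      using comm[of "X (Suc n)"] n assms(4)[of "Suc n"] by (simp add: poly_ring_X)
    also have "\<dots> = (\<Sum>i=1..Suc n. kravchuk2 N (C (B (Suc n) i) * X i))"
      using n by (intro q_linear_sum[OF klin] poly_ring_mult poly_ring_C) (simp add: poly_ring_X)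
    also have "\<dots> = (\<Sum>i=1..Suc n. C (B (Suc n) i) * kravchuk2_value i)"
    proof (rule sum.cong)
      fix i assume "i \<in> {1..Suc n}"
      then show "kravchuk2 N (C (B (Suc n) i) * X i) = C (B (Suc n) i) * kravchuk2_value i"
        using klin n by (simp add: q_linear_def poly_ring_X kravchuk2_X kravchuk2_value_def)
    qed simp
    finally have "var_coeff (C (of_nat (Suc n)) * \<psi> (X n)) j =
        var_coeff (\<Sum>i=1..Suc n. C (B (Suc n) i) * kravchuk2_value i) j"
      by simp
    then have "of_nat (Suc n) * var_coeff (\<psi> (X n)) j
        = (\<Sum>k=1..Suc n. B (Suc n) k * log_coeff k j)"
      by (simp only: lookup_C_mult lookup_sum var_coeff_kravchuk2_value)
    also have "\<dots> = (\<Sum>k=1..Suc n. var_coeff (\<psi> (X (Suc n))) k * log_coeff k j)"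
      using n by (intro sum.cong) (simp_all add: coeff)
    finally show ?thesis by simp
  qed
  have main: "var_coeff (\<psi> (X n)) k = surj_count n k" if "n \<le> N" "k \<le> n" for n k
    using that
  proof (induction n arbitrary: k)
    case 0
    then show ?case by (simp add: assms(3) var_coeff_X surj_count_0_left)
  next
    case (Suc n)
    show ?case
    proof (cases "k = 0")
      \<comment> \<open>Column 0 is not an unknown of the system: it vanishes because the form of
        \<psi> has no x_0 term.\<close>
      case True
      then show ?thesis using Suc.prems by (simp add: coeff surj_count_Suc_0)
    next
      case False
      show ?thesis
      \<comment> \<open>Both candidates for row \<open>Suc n\<close> solve the same system: its
        right-hand sides come from row \<open>n\<close>, where they agree by induction.\<close>
      proof (rule log_system_unique)
        fix j assume "j < Suc n"
        then show "(\<Sum>k=1..Suc n. var_coeff (\<psi> (X (Suc n))) k * log_coeff k j)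
            = (\<Sum>k=1..Suc n. surj_count (Suc n) k * log_coeff k j)"
          using Suc by (simp only: recurrence surj_count_recurrence less_Suc_eq_le)
      qed (use False Suc.prems in simp_all)
    qed
  qed
  show ?thesis
  proof (intro allI impI)
    fix n k assume nk: "1 \<le> k \<and> k \<le> n \<and> n \<le> N"
    then have "B n k = var_coeff (\<psi> (X n)) k"
      by (simp add: coeff)
    with main nk show "B n k = fact k * of_nat (Stirling n k)"
      by (simp add: surj_count_def)
  qed
qed

end
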